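(* Let $X=(x_1,\dots,x_n)$ be a pitch-class segment in $\mathbb{Z}_m$, $S$ its $T/I$-orbit, $f\colon\mathbb{Z}_m\to\mathbb{Z}_m$ an affine map ($f(z)=az+b$ with $a,b\in\mathbb{Z}_m$), and $G_0$ a subgroup of the contextual group for $X$ which is generated by contextual inversions $J^{q,r}$. Let $G'$ and $S'$ be the contextual group and the $T/I$-orbit for $f(X)$. Assume that $X$ and $f(X)$ satisfy the tritone condition. Let $\varphi\colon G_0\to G'$ be the homomorphism $J^{q,r}\mapsto J^{q,r}$ (sending each generating contextual inversion $J^{q,r}$ on $S$ to the contextual inversion $J^{q,r}$ with the same indices on $S'$). Then $$(f,\varphi)\colon(G_0,S)\to(G',S')$$ is a morphism of group actions. The restriction to $S_0:=G_0X$ is a morphism $$(f,\varphi)\colon(G_0,S_0)\to(G',S')$$ of simply transitive group actions.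
   Context: A pitch-class segment in $\mathbb{Z}_m$ is an $n$-tuple $X=(x_1,\dots,x_n)$ of elements of $\mathbb{Z}_m$. For $i\in\mathbb{Z}_m$ let $T_i(x)=x+i$ and $I_i(x)=-x+i$; the mod $m$ $T/I$-group consists of all $T_i$ and $I_i$. These maps, and affine maps $f$, act on $n$-tuples componentwise. The $T/I$-orbit $S$ of $X$ is the set of all $T_i(X)$ (the $T$-forms) and $I_i(X)$ (the $I$-forms). The tuple $X$ satisfies the tritone condition if there exist two distinct pitch classes $x_q,x_r$ in $X$ which span an interval other than $m/2$ (i.e. $x_q\neq x_r$ and $2x_q\neq 2x_r$ in $\mathbb{Z}_m$). Define bijections $K,Q_i\colon S\to S$, for $Y=(y_1,\dots,y_n)\in S$, by $K(Y)=I_{y_1+y_2}(Y)$, and $Q_i(Y)=T_i(Y)$ if $Y$ is a $T$-form of $X$, $Q_i(Y)=T_{-i}(Y)$ if $Y$ is an $I$-form of $X$. The contextual group for (associated to) $X$ is the subgroup of $\mathrm{Sym}(S)$ generated by $K$ and $Q_1$. For indices $q,r$ the contextual inversion $J^{q,r}\colon S\to S$ is $J^{q,r}(Y)=I_{y_q+y_r}(Y)$. Known facts: when $X$ satisfies the tritone condition, the contextual group and the $T/I$-group act simply transitively on $S$, are each other's centralizers in $\mathrm{Sym}(S)$, and every $J^{q,r}$ lies in the contextual group. The same definitions and facts apply to $f(X)$ and $S'$. A morphism of group actions $(f,\varphi)\colon(G_1,S_1)\to(G_2,S_2)$ consists of a function $f\colon S_1\to S_2$ and a group homomorphism $\varphi\colon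 G_1\to G_2$ with $f(gs)=\varphi(g)f(s)$ for all $g\in G_1,s\in S_1$. It is a morphism of simply transitive group actions if both actions are simply transitive, where an action of $G$ on $S$ is simply transitive if each pair $s,t\in S$ admits a unique $g\in G$ with $gs=t$. *)

theory Defs
  imports "HOL-Number_Theory.Residues" "HOL-Algebra.Group_Action"
begin

text \<open>The ring of integers modulo \<open>m\<close>, with carrier \<open>{0..<m}\<close>. A pitch-class segment
  \<open>(x\<^sub>1, \<dots>, x\<^sub>n)\<close> is a list over this carrier, so the entry \<open>x\<^sub>q\<close>
  is \<open>X ! (q - 1)\<close>; all indices below are counted from 0.\<close>

abbreviation Zmod :: "nat \<Rightarrow> int ring" where
  "Zmod m \<equiv> residue_ring (int m)"

definition transp :: "nat \<Rightarrow> int \<Rightarrow> int \<Rightarrow> int" where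
  "transp m i x = x \<oplus>\<^bsub>Zmod m\<^esub> i"

definition inversion :: "nat \<Rightarrow> int \<Rightarrow> int \<Rightarrow> int" where
  "inversion m i x = (\<ominus>\<^bsub>Zmod m\<^esub> x) \<oplus>\<^bsub>Zmod m\<^esub> i"

definition T_forms :: "nat \<Rightarrow> int list \<Rightarrow> int list set" where
  "T_forms m X = {map (transp m i) X | i. i \<in> carrier (Zmod m)}"

definition I_forms :: "nat \<Rightarrow> int list \<Rightarrow> int list set" where
  "I_forms m X = {map (inversion m i) X | i. i \<in> carrier (Zmod m)}"

definition TI_orbit :: "nat \<Rightarrow> int list \<Rightarrow> int list set" where
  "TI_orbit m X = T_forms m X \<union> I_forms m X"

definition tritone_condition :: "nat \<Rightarrow> int list \<Rightarrow> bool" where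
  "tritone_condition m X \<longleftrightarrow>
     (\<exists>q < length X. \<exists>r < length X. X ! q \<noteq> X ! r \<and>
        X ! q \<oplus>\<^bsub>Zmod m\<^esub> X ! q \<noteq> X ! r \<oplus>\<^bsub>Zmod m\<^esub> X ! r)"

text \<open>Following \<^const>\<open>BijGroup\<close>, permutations of the orbit of \<open>X\<close> are extensional functions:
  they are undefined off the orbit.\<close>

definition contextual_inversion :: "nat \<Rightarrow> int list \<Rightarrow> nat \<Rightarrow> nat \<Rightarrow> int list \<Rightarrow> int list" where
  "contextual_inversion m X q r =
     (\<lambda>Y \<in> TI_orbit m X. map (inversion m (Y ! q \<oplus>\<^bsub>Zmod m\<^esub> Y ! r)) Y)"

definition K_perm :: "nat \<Rightarrow> int list \<Rightarrow> int list \<Rightarrow> int list" where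
  "K_perm m X = (\<lambda>Y \<in> TI_orbit m X. map (inversion m (Y ! 0 \<oplus>\<^bsub>Zmod m\<^esub> Y ! 1)) Y)"

text \<open>Under the tritone condition no \<open>T\<close>-form of \<open>X\<close> is an \<open>I\<close>-form, so the
  else-branch treats exactly the \<open>I\<close>-forms.\<close>

definition Q_perm :: "nat \<Rightarrow> int list \<Rightarrow> int \<Rightarrow> int list \<Rightarrow> int list" where
  "Q_perm m X i =
     (\<lambda>Y \<in> TI_orbit m X. if Y \<in> T_forms m X then map (transp m i) Y
                         else map (transp m (\<ominus>\<^bsub>Zmod m\<^esub> i)) Y)"

definition contextual_group :: "nat \<Rightarrow> int list \<Rightarrow> (int list \<Rightarrow> int list) monoid" where
  "contextual_group m X =
     (BijGroup (TI_orbit m X))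
       \<lparr>carrier := generate (BijGroup (TI_orbit m X)) {K_perm m X, Q_perm m X \<one>\<^bsub>Zmod m\<^esub>}\<rparr>"

text \<open>The evaluation action, on an invariant set \<open>A\<close>, of a group of permutations of a set
  containing \<open>A\<close>. Restricting to \<open>A\<close> yields an extensional function on \<open>A\<close>, as
  \<^const>\<open>BijGroup\<close> requires.\<close>

definition eval_action :: "'a set \<Rightarrow> ('a \<Rightarrow> 'a) \<Rightarrow> 'a \<Rightarrow> 'a" where
  "eval_action A g = restrict g A"

definition simply_transitive :: "('g, 'c) monoid_scheme \<Rightarrow> 's set \<Rightarrow> ('g \<Rightarrow> 's \<Rightarrow> 's) \<Rightarrow> bool" where
  "simply_transitive G A \<alpha> \<longleftrightarrow>
     group_action G A \<alpha> \<and> (\<forall>s \<in> A. \<forall>t \<in> A. \<exists>!g. g \<in> carrier G \<and> \<alpha> g s = t)"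

definition action_morphism ::
  "('s \<Rightarrow> 't) \<Rightarrow> ('g \<Rightarrow> 'h) \<Rightarrow> ('g, 'c) monoid_scheme \<Rightarrow> 's set \<Rightarrow> ('g \<Rightarrow> 's \<Rightarrow> 's)
     \<Rightarrow> ('h, 'd) monoid_scheme \<Rightarrow> 't set \<Rightarrow> ('h \<Rightarrow> 't \<Rightarrow> 't) \<Rightarrow> bool" where
  "action_morphism f \<phi> G A \<alpha> H B \<beta> \<longleftrightarrow>
     group_action G A \<alpha> \<and> group_action H B \<beta> \<and> f \<in> A \<rightarrow> B \<and> \<phi> \<in> hom G H \<and>
     (\<forall>g \<in> carrier G. \<forall>s \<in> A. f (\<alpha> g s) = \<beta> (\<phi> g) (f s))"

definition simply_transitive_morphism ::
  "('s \<Rightarrow> 't) \<Rightarrow> ('g \<Rightarrow> 'h) \<Rightarrow> ('g, 'c) monoid_scheme \<Rightarrow> 's set \<Rightarrow> ('g \<Rightarrow> 's \<Rightarrow> 's)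
     \<Rightarrow> ('h, 'd) monoid_scheme \<Rightarrow> 't set \<Rightarrow> ('h \<Rightarrow> 't \<Rightarrow> 't) \<Rightarrow> bool" where
  "simply_transitive_morphism f \<phi> G A \<alpha> H B \<beta> \<longleftrightarrow>
     action_morphism f \<phi> G A \<alpha> H B \<beta> \<and> simply_transitive G A \<alpha> \<and> simply_transitive H B \<beta>"

end

theory Submission
  imports Defs
begin

text \<open>The \<open>T/I\<close>-group acts transitively on the orbit \<open>S\<close> of \<open>X\<close>, so an equivariant self-map of
  \<open>S\<close> is determined by its value at one point. The tritone condition separates \<open>T\<close>-forms from
  \<open>I\<close>-forms and thereby makes \<open>Q\<^sub>1\<close> equivariant; as \<open>K\<close> and \<open>Q\<^sub>1\<close> already act
  transitively, the contextual group is exactly the set of equivariant self-maps of \<open>S\<close>. Hence it is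
  simply transitive and contains every \<open>J\<^sup>q\<^sup>r\<close>. An affine map \<open>f\<close> satisfies
  \<open>f (J\<^sup>q\<^sup>r Y) = J\<^sup>q\<^sup>r (f Y)\<close>, so every \<open>g\<close> generated by contextual inversions admits a \<open>g'\<close> in the
  contextual group of \<open>f(X)\<close> with \<open>f \<circ> g = g' \<circ> f\<close>; by simple transitivity \<open>g'\<close> is unique, and
  \<open>g \<mapsto> g'\<close> is the homomorphism.\<close>

section \<open>Groups of permutations\<close>

lemma group_BijGroup_subgroup:
  "subgroup H (BijGroup S) \<Longrightarrow> group ((BijGroup S)\<lparr>carrier := H\<rparr>)"
  by (rule subgroup.subgroup_is_group[OF _ group_BijGroup])

lemma subgroup_BijGroup_Bij: "subgroup H (BijGroup S) \<Longrightarrow> g \<in> H \<Longrightarrow> g \<in> Bij S"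
  using subgroup.subset by (fastforce simp: BijGroup_def)

lemma BijGroup_mult:
  "g \<in> Bij S \<Longrightarrow> h \<in> Bij S \<Longrightarrow> g \<otimes>\<^bsub>BijGroup S\<^esub> h = compose S g h"
  by (simp add: BijGroup_def)

lemma BijGroup_one: "\<one>\<^bsub>BijGroup S\<^esub> = (\<lambda>x\<in>S. x)"
  by (simp add: BijGroup_def)

lemma BijGroup_inv_apply:
  assumes "g \<in> Bij S" "s \<in> S"
  shows "g ((inv\<^bsub>BijGroup S\<^esub> g) s) = s" and "(inv\<^bsub>BijGroup S\<^esub> g) (g s) = s"
    and "(inv\<^bsub>BijGroup S\<^esub> g) s \<in> S"
proof -
  have b: "bij_betw g S S" using assms(1) by (simp add: Bij_def)
  then have "g s \<in> S" using assms(2) by (rule bij_betwE[THEN bspec])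
  then show "g ((inv\<^bsub>BijGroup S\<^esub> g) s) = s" "(inv\<^bsub>BijGroup S\<^esub> g) (g s) = s" "(inv\<^bsub>BijGroup S\<^esub> g) s \<in> S"
    using b assms by (auto simp: inv_BijGroup bij_betw_inv_into_left bij_betw_inv_into_right
        Bij_inv_into_mem)
qed

text \<open>Invariance gives only one inclusion. Applied to the inverse of \<open>g\<close>, which
  also lies in \<open>H\<close>, it gives the other, so \<open>g\<close> permutes
  \<open>A\<close>.\<close>

lemma group_action_eval_action:
  assumes H: "subgroup H (BijGroup S)" and "A \<subseteq> S" and inv: "\<And>g. g \<in> H \<Longrightarrow> g ` A \<subseteq> A"
  shows "group_action ((BijGroup S)\<lparr>carrier := H\<rparr>) A (eval_action A)"
proof -
  have Bij: "eval_action A g \<in> Bij A" if g: "g \<in> H" for g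
  proof -
    have gB: "g \<in> Bij S" using subgroup_BijGroup_Bij[OF H g] .
    have "inv\<^bsub>BijGroup S\<^esub> g \<in> H" using subgroup.m_inv_closed[OF H g] .
    then have "A \<subseteq> g ` A"
      using inv[of "inv\<^bsub>BijGroup S\<^esub> g"] BijGroup_inv_apply(1)[OF gB] \<open>A \<subseteq> S\<close>
      by (metis image_eqI image_subset_iff subset_iff)
    moreover have "inj_on g A"
      using gB \<open>A \<subseteq> S\<close> by (auto simp: Bij_def bij_betw_def intro: inj_on_subset)
    ultimately show ?thesis
      using inv[OF g] by (auto simp: Bij_def bij_betw_def eval_action_def inj_on_def)
  qed
  have "eval_action A (g \<otimes>\<^bsub>BijGroup S\<^esub> h) = eval_action A g \<otimes>\<^bsub>BijGroup A\<^esub> eval_action A h"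
    if g: "g \<in> H" and h: "h \<in> H" for g h
    using inv[OF h] \<open>A \<subseteq> S\<close> unfolding BijGroup_mult[OF Bij[OF g] Bij[OF h]]
    by (auto simp: BijGroup_mult g h subgroup_BijGroup_Bij[OF H] eval_action_def compose_def
        fun_eq_iff restrict_def)
  then show ?thesis
    unfolding group_action_def group_hom_def group_hom_axioms_def
    using group_BijGroup_subgroup[OF H] group_BijGroup[of A] Bij
    by (auto simp: hom_def BijGroup_def)
qed

lemma orbit_eval_action:
  "x \<in> S \<Longrightarrow> orbit ((BijGroup S)\<lparr>carrier := H\<rparr>) (eval_action S) x = (\<lambda>g. g x) ` H"
  by (auto simp: orbit_def eval_action_def)

lemma subgroup_image_orbit:
  assumes H: "subgroup H (BijGroup S)" and x: "x \<in> S" and h: "h \<in> H"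
  shows "h ` (\<lambda>g. g x) ` H \<subseteq> (\<lambda>g. g x) ` H"
proof clarify
  fix g assume g: "g \<in> H"
  then have "h (g x) = (h \<otimes>\<^bsub>BijGroup S\<^esub> g) x"
    using h x subgroup_BijGroup_Bij[OF H] by (simp add: BijGroup_mult compose_def)
  then show "h (g x) \<in> (\<lambda>g. g x) ` H" using subgroup.m_closed[OF H h g] by blast
qed

text \<open>The element h g^-1 takes g x to h x. Because \<open>free\<close> yields equality on all
  of \<open>S\<close>, uniqueness holds in \<open>H\<close> itself even if the orbit is a proper
  subset of \<open>S\<close>.\<close>

lemma simply_transitive_orbit:
  assumes H: "subgroup H (BijGroup S)" and x: "x \<in> S"
    and free: "\<And>g h s. g \<in> H \<Longrightarrow> h \<in> H \<Longrightarrow> s \<in> S \<Longrightarrow> g s = h s \<Longrightarrow> g = h"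
  shows "simply_transitive ((BijGroup S)\<lparr>carrier := H\<rparr>) ((\<lambda>g. g x) ` H)
           (eval_action ((\<lambda>g. g x) ` H))"
proof -
  let ?A = "(\<lambda>g. g x) ` H"
  have AS: "?A \<subseteq> S"
    using x subgroup_BijGroup_Bij[OF H] Bij_imp_funcset by blast
  have "\<exists>!k. k \<in> H \<and> k s = t" if s: "s \<in> ?A" and t: "t \<in> ?A" for s t
  proof -
    from s t obtain g h where g: "g \<in> H" "s = g x" and h: "h \<in> H" "t = h x" by blast
    let ?k = "h \<otimes>\<^bsub>BijGroup S\<^esub> inv\<^bsub>BijGroup S\<^esub> g"
    have ig: "inv\<^bsub>BijGroup S\<^esub> g \<in> H" using subgroup.m_inv_closed[OF H g(1)] .
    have "?k s = t"
      using s AS g h ig x subgroup_BijGroup_Bij[OF H]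
      by (auto simp: BijGroup_mult compose_def BijGroup_inv_apply)
    moreover have "?k \<in> H" using subgroup.m_closed[OF H h(1) ig] .
    ultimately show ?thesis using free s AS by (metis subset_iff)
  qed
  then show ?thesis
    unfolding simply_transitive_def
    using group_action_eval_action[OF H AS subgroup_image_orbit[OF H x]]
    by (auto simp: eval_action_def)
qed

section \<open>Permutations related through a map of the underlying sets\<close>

definition intertwines :: "'a set \<Rightarrow> ('a \<Rightarrow> 'b) \<Rightarrow> ('a \<Rightarrow> 'a) \<Rightarrow> ('b \<Rightarrow> 'b) \<Rightarrow> bool" where
  "intertwines S f g g' \<longleftrightarrow> (\<forall>s\<in>S. f (g s) = g' (f s))"

lemma intertwines_one:
  "f \<in> S \<rightarrow> S' \<Longrightarrow> intertwines S f \<one>\<^bsub>BijGroup S\<^esub> \<one>\<^bsub>BijGroup S'\<^esub>"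
  by (auto simp: intertwines_def BijGroup_one)

lemma intertwines_mult:
  assumes "f \<in> S \<rightarrow> S'" "g \<in> Bij S" "h \<in> Bij S" "g' \<in> Bij S'" "h' \<in> Bij S'"
    and "intertwines S f g g'" "intertwines S f h h'"
  shows "intertwines S f (g \<otimes>\<^bsub>BijGroup S\<^esub> h) (g' \<otimes>\<^bsub>BijGroup S'\<^esub> h')"
  using assms Bij_imp_funcset[OF assms(3)] by (auto simp: intertwines_def BijGroup_mult compose_def Pi_iff)

lemma intertwines_inv:
  assumes f: "f \<in> S \<rightarrow> S'" and g: "g \<in> Bij S" and g': "g' \<in> Bij S'" and "intertwines S f g g'"
  shows "intertwines S f (inv\<^bsub>BijGroup S\<^esub> g) (inv\<^bsub>BijGroup S'\<^esub> g')"
  unfolding intertwines_def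
proof
  fix s assume s: "s \<in> S"
  let ?t = "(inv\<^bsub>BijGroup S\<^esub> g) s"
  have t: "?t \<in> S" "g ?t = s" using BijGroup_inv_apply[OF g s] by auto
  then have "f s = g' (f ?t)" using assms(4) unfolding intertwines_def by metis
  then show "f ?t = (inv\<^bsub>BijGroup S'\<^esub> g') (f s)"
    using BijGroup_inv_apply(2)[OF g' funcset_mem[OF f t(1)]] by simp
qed

context
  fixes S :: "'a set" and S' :: "'b set" and H' :: "('b \<Rightarrow> 'b) set" and f :: "'a \<Rightarrow> 'b"
    and P :: "'p set" and J :: "'p \<Rightarrow> 'a \<Rightarrow> 'a" and J' :: "'p \<Rightarrow> 'b \<Rightarrow> 'b" and H :: "('a \<Rightarrow> 'a) set"
  assumes H': "subgroup H' (BijGroup S')" and f: "f \<in> S \<rightarrow> S'"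
    and J: "J ` P \<subseteq> Bij S" and J': "J' ` P \<subseteq> H'"
    and fJ: "\<And>p. p \<in> P \<Longrightarrow> intertwines S f (J p) (J' p)"
    and H: "H = generate (BijGroup S) (J ` P)"
begin

lemma subgroup_H: "subgroup H (BijGroup S)"
  unfolding H by (rule group.generate_is_subgroup[OF group_BijGroup]) (use J in \<open>simp add: BijGroup_def\<close>)

text \<open>The equivariance required of a morphism holds on the generators by \<open>fJ\<close> and
  passes to products and inverses.\<close>

lemma hom_intertwines:
  assumes \<phi>: "\<phi> \<in> hom ((BijGroup S)\<lparr>carrier := H\<rparr>) ((BijGroup S')\<lparr>carrier := H'\<rparr>)"
    and \<phi>J: "\<And>p. p \<in> P \<Longrightarrow> \<phi> (J p) = J' p" and g: "g \<in> H"
  shows "intertwines S f g (\<phi> g)"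
proof -
  let ?G = "(BijGroup S)\<lparr>carrier := H\<rparr>" and ?G' = "(BijGroup S')\<lparr>carrier := H'\<rparr>"
  interpret \<phi>: group_hom ?G ?G' \<phi>
    using \<phi> group_BijGroup_subgroup[OF H'] group_BijGroup_subgroup[OF subgroup_H]
    by (simp add: group_hom_def group_hom_axioms_def)
  have Bij: "h \<in> Bij S" "\<phi> h \<in> Bij S'" if "h \<in> H" for h
    using subgroup_BijGroup_Bij[OF subgroup_H that] \<phi>.hom_closed that subgroup_BijGroup_Bij[OF H']
    by auto
  have "g \<in> generate (BijGroup S) (J ` P)" using g H by simp
  then show ?thesis
  proof induction
    case one
    then show ?case using intertwines_one[OF f] \<phi>.hom_one by simp
  next
    case (incl h)
    then show ?case using fJ \<phi>J by auto
  next
    case (inv h)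
    then have h: "h \<in> H" and ih: "intertwines S f h (\<phi> h)"
      using H fJ \<phi>J by (auto intro: generate.incl)
    \<comment> \<open>The induction inverts in the full symmetric group, whereas
      \<open>\<phi>\<close> respects inversion in \<open>H\<close> and \<open>H'\<close>; the two
      inverses agree on a subgroup.\<close>
    have "\<phi> (inv\<^bsub>BijGroup S\<^esub> h) = inv\<^bsub>BijGroup S'\<^esub> (\<phi> h)"
      using \<phi>.hom_inv[of h] \<phi>.hom_closed[of h] h
      by (simp add: group.m_inv_consistent[OF group_BijGroup subgroup_H]
          group.m_inv_consistent[OF group_BijGroup H'])
    then show ?case using intertwines_inv[OF f Bij[OF h] ih] by simp
  next
    case (eng h k)
    then have "h \<in> H" "k \<in> H" using H by auto
    then show ?case
      using intertwines_mult[OF f] Bij eng.IH \<phi>.hom_mult[of h k] by auto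
  qed
qed

text \<open>One permutation may be \<open>J p\<close> for several \<open>p\<close>, and relations
  among the \<open>J p\<close> need not visibly hold among the \<open>J' p\<close>, so no
  homomorphism is at hand yet. A word in the \<open>J p\<close> is therefore only related to the
  same word in the \<open>J' p\<close>.\<close>

lemma ex_intertwines:
  assumes "g \<in> H" shows "\<exists>g'\<in>H'. intertwines S f g g'"
proof -
  note Bij = subgroup_BijGroup_Bij[OF subgroup_H] subgroup_BijGroup_Bij[OF H']
  have "g \<in> generate (BijGroup S) (J ` P)" using assms H by simp
  then show ?thesis
  proof induction
    case one
    then show ?case using intertwines_one[OF f] subgroup.one_closed[OF H'] by blast
  next
    case (incl h)
    then show ?case using fJ J' by blast
  next
    case (inv h)
    then obtain p where p: "p \<in> P" "h = J p" by blast
    then have "h \<in> H" "J' p \<in> H'" using H J' by (auto intro: generate.incl)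
    then show ?case
      using intertwines_inv[OF f Bij fJ[OF p(1), folded p(2)]] subgroup.m_inv_closed[OF H'] by blast
  next
    case (eng h k)
    then obtain h' k' where "h' \<in> H'" "intertwines S f h h'" "k' \<in> H'" "intertwines S f k k'"
      by blast
    moreover have "h \<in> H" "k \<in> H" using eng.hyps H by auto
    ultimately show ?case
      using intertwines_mult[OF f] Bij subgroup.m_closed[OF H'] by blast
  qed
qed

text \<open>Freeness of \<open>H'\<close> turns the relation \<open>intertwines\<close> into a
  function on \<open>H\<close>, so the assignment on generators is well defined. A competing
  homomorphism satisfies the same relation and hence has the same values.\<close>

lemma ex1_hom:
  assumes x: "x \<in> S"
    and free: "\<And>g h s. g \<in> H' \<Longrightarrow> h \<in> H' \<Longrightarrow> s \<in> S' \<Longrightarrow> g s = h s \<Longrightarrow> g = h"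
  shows "\<exists>!\<phi>. \<phi> \<in> extensional H \<and>
           \<phi> \<in> hom ((BijGroup S)\<lparr>carrier := H\<rparr>) ((BijGroup S')\<lparr>carrier := H'\<rparr>) \<and>
           (\<forall>p\<in>P. \<phi> (J p) = J' p)"
proof -
  \<comment> \<open>Both candidates send \<open>f x\<close> to \<open>f (g x)\<close>, and one
    common value suffices by freeness; the point \<open>x\<close> is needed for this.\<close>
  have unique: "g' = h'"
    if "g' \<in> H'" "h' \<in> H'" "intertwines S f g g'" "intertwines S f g h'" for g g' h'
    using that free[of g' h' "f x"] x f by (auto simp: intertwines_def)
  define \<psi> where "\<psi> = (\<lambda>g\<in>H. SOME g'. g' \<in> H' \<and> intertwines S f g g')"
  have \<psi>: "\<psi> g \<in> H' \<and> intertwines S f g (\<psi> g)" if "g \<in> H" for g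
    using someI_ex[OF ex_intertwines[OF that, unfolded Bex_def]] that by (simp add: \<psi>_def)
  have JH: "J p \<in> H" if "p \<in> P" for p
    unfolding H using that by (auto intro: generate.incl)
  note Bij = subgroup_BijGroup_Bij[OF subgroup_H] subgroup_BijGroup_Bij[OF H']
  \<comment> \<open>Both sides are related to the product of \<open>g\<close> and \<open>h\<close>,
    so \<open>unique\<close> identifies them.\<close>
  have "\<psi> (g \<otimes>\<^bsub>BijGroup S\<^esub> h) = \<psi> g \<otimes>\<^bsub>BijGroup S'\<^esub> \<psi> h" if "g \<in> H" "h \<in> H" for g h
    using that
    by (intro unique[of _ _ "g \<otimes>\<^bsub>BijGroup S\<^esub> h"])
      (use \<psi> Bij subgroup.m_closed[OF subgroup_H] subgroup.m_closed[OF H'] in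
        \<open>auto intro!: intertwines_mult[OF f]\<close>)
  then have "\<psi> \<in> hom ((BijGroup S)\<lparr>carrier := H\<rparr>) ((BijGroup S')\<lparr>carrier := H'\<rparr>)"
    using \<psi> by (auto simp: hom_def)
  moreover have "\<psi> (J p) = J' p" if "p \<in> P" for p
    using unique \<psi>[OF JH[OF that]] fJ[OF that] J' that by blast
  moreover have "\<psi> \<in> extensional H" by (simp add: \<psi>_def)
  ultimately show ?thesis
  proof (intro ex1I[of _ \<psi>] conjI ballI, goal_cases)
    case (4 \<phi>)
    then have \<phi>: "\<phi> \<in> hom ((BijGroup S)\<lparr>carrier := H\<rparr>) ((BijGroup S')\<lparr>carrier := H'\<rparr>)" by blast
    show ?case
    proof (rule extensionalityI[of _ H])
      fix g assume g: "g \<in> H"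
      then show "\<phi> g = \<psi> g"
        using unique \<psi>[OF g] hom_intertwines[OF \<phi> _ g] hom_in_carrier[OF \<phi>, of g] 4 by simp
    qed (use 4 in auto)
  qed auto
qed

end

section \<open>The contextual group as a centralizer\<close>

definition affine :: "nat \<Rightarrow> int \<Rightarrow> int \<Rightarrow> int list \<Rightarrow> int list" where
  "affine m e i = map (\<lambda>y. (e * y + i) mod int m)"

lemma length_affine [simp]: "length (affine m e i Y) = length Y"
  by (simp add: affine_def)

lemma nth_affine [simp]: "q < length Y \<Longrightarrow> affine m e i Y ! q = (e * Y ! q + i) mod int m"
  by (simp add: affine_def)

text \<open>Transpositions (\<open>e = 1\<close>), inversions (\<open>e = -1\<close>) and the map f
  share one form, so commutation claims reduce to comparing integer coefficients modulo
  \<open>m\<close>.\<close>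

lemma affine_affine: "affine m e i (affine m e' i' Y) = affine m (e * e') (e * i' + i) Y"
proof -
  have "(e * ((e' * y + i') mod int m) + i) mod int m = (e * e' * y + (e * i' + i)) mod int m" for y
    by (metis (no_types, opaque_lifting) ab_semigroup_add_class.add_ac(1) distrib_left mod_add_left_eq
        mod_mult_right_eq mult.assoc)
  then show ?thesis by (simp add: affine_def)
qed

lemma affine_cong: "[i = j] (mod int m) \<Longrightarrow> affine m e i = affine m e j"
  by (auto simp: affine_def cong_def fun_eq_iff intro: mod_add_cong)

lemma affine_mod: "affine m e (i mod int m) = affine m e i"
  by (rule affine_cong) (simp add: cong_def)

lemma affine_one_zero: "set Y \<subseteq> {0..<int m} \<Longrightarrow> affine m 1 0 Y = Y"
  by (auto simp: affine_def intro!: map_idI)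

text \<open>Entries of an affine image come already reduced; this removes the reductions when two of
  them are added in a contextual inversion.\<close>

lemma cong_mod_add_mod_diff: "[x mod k + y mod k - z = x + y - z] (mod (k::int))"
  by (intro cong_diff cong_add cong_refl) (simp_all add: cong_def)

section \<open>The T/I-orbit of a segment with the tritone condition\<close>

locale tritone_segment =
  fixes m :: nat and X :: "int list"
  assumes m_ge_1: "m \<ge> 1" and X_carrier: "set X \<subseteq> carrier (Zmod m)"
    and tritone: "tritone_condition m X"
begin

abbreviation "S \<equiv> TI_orbit m X"

lemma carrier_Zmod: "carrier (Zmod m) = {0..<int m}"
  by (auto simp: residue_ring_def)

lemma add_Zmod: "x \<oplus>\<^bsub>Zmod m\<^esub> y = (x + y) mod int m"
  by (simp add: residue_ring_def)

lemma X_range: "set X \<subseteq> {0..<int m}"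
  using X_carrier carrier_Zmod by simp

lemma m_gt_1: "int m > 1"
proof (rule ccontr)
  assume "\<not> int m > 1"
  then have "m = 1" using m_ge_1 by linarith
  then have "\<forall>q<length X. X ! q = 0" using X_range nth_mem by fastforce
  then show False using tritone by (auto simp: tritone_condition_def)
qed

sublocale residues "int m" "Zmod m"
  by unfold_locales (use m_gt_1 in auto)

lemma length_X: "length X \<ge> 2"
proof -
  obtain q r where "q < length X" "r < length X" "q \<noteq> r"
    using tritone by (auto simp: tritone_condition_def)
  then show ?thesis by linarith
qed

lemma map_transp: "map (transp m i) Y = affine m 1 i Y"
  by (simp add: affine_def transp_def add_Zmod)

lemma map_inversion: "map (inversion m i) Y = affine m (-1) i Y"
  by (simp add: affine_def inversion_def add_Zmod res_neg_eq mod_simps)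

lemma T_forms_iff: "Y \<in> T_forms m X \<longleftrightarrow> (\<exists>i. Y = affine m 1 i X)"
  unfolding T_forms_def map_transp carrier_Zmod
  using m_gt_1 by (auto, metis affine_mod atLeastLessThan_iff pos_mod_bound pos_mod_sign less_trans zero_less_one)

lemma I_forms_iff: "Y \<in> I_forms m X \<longleftrightarrow> (\<exists>i. Y = affine m (-1) i X)"
  unfolding I_forms_def map_inversion carrier_Zmod
  using m_gt_1 by (auto, metis affine_mod atLeastLessThan_iff pos_mod_bound pos_mod_sign less_trans zero_less_one)

lemma S_iff: "Y \<in> S \<longleftrightarrow> (\<exists>e\<in>{1, -1}. \<exists>i. Y = affine m e i X)"
  by (auto simp: TI_orbit_def T_forms_iff I_forms_iff)

lemma affine_in_S: "Y \<in> S \<Longrightarrow> e \<in> {1, -1} \<Longrightarrow> affine m e i Y \<in> S"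
  by (auto simp: S_iff affine_affine)

lemma X_in_S: "X \<in> S"
  unfolding S_iff using affine_one_zero[OF X_range] by (metis insertI1)

lemma length_S: "Y \<in> S \<Longrightarrow> length Y = length X"
  by (auto simp: S_iff)

lemma S_range: "Y \<in> S \<Longrightarrow> set Y \<subseteq> {0..<int m}"
  using m_gt_1 by (auto simp: S_iff affine_def)

lemma S_transitive:
  assumes "Y \<in> S" "Z \<in> S" obtains e i where "e \<in> {1, -1}" "Z = affine m e i Y"
proof -
  obtain e i e' i' where e: "e \<in> {1, -1}" "Y = affine m e i X" and e': "e' \<in> {1, -1}" "Z = affine m e' i' X"
    using assms unfolding S_iff by blast
  \<comment> \<open>A sign is its own inverse, so X = e (Y - i); substituting into Z = e' X + i'
    gives these coefficients.\<close>
  then have "Z = affine m (e * e') (i' - e * e' * i) Y" "e * e' \<in> {1, -1}"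
    by (auto simp: affine_affine)
  then show ?thesis using that by blast
qed

lemma finite_S: "finite S"
  by (simp add: TI_orbit_def T_forms_def I_forms_def carrier_Zmod setcompr_eq_image)

text \<open>Equality at position q reads 2 x_q = j - i, with the right side independent of q. All
  doubled entries would then coincide, against the tritone condition.\<close>

lemma T_neq_I: "affine m 1 i X \<noteq> affine m (-1) j X"
proof
  assume eq: "affine m 1 i X = affine m (-1) j X"
  have *: "[X ! q + X ! q = j - i] (mod int m)" if "q < length X" for q
  proof -
    have "(X ! q + i) mod int m = (j - X ! q) mod int m"
      using arg_cong[OF eq, of "\<lambda>Y. Y ! q"] that by simp
    then show ?thesis by (simp add: cong_def mod_eq_dvd_iff algebra_simps)
  qed
  obtain q r where "q < length X" "r < length X" "(X ! q + X ! q) mod int m \<noteq> (X ! r + X ! r) mod int m"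
    using tritone by (auto simp: tritone_condition_def add_Zmod)
  then show False using *[of q] *[of r] by (simp add: cong_def)
qed

text \<open>Bijectivity is not demanded: it follows from equivariance, see
  \<open>centralizer_Bij\<close>. Extensionality makes agreement on \<open>S\<close> equality in
  \<open>BijGroup\<close>.\<close>

definition centralizer :: "(int list \<Rightarrow> int list) set" where
  "centralizer = {g \<in> extensional S. g \<in> S \<rightarrow> S \<and>
     (\<forall>e\<in>{1, -1}. \<forall>i. \<forall>Y\<in>S. g (affine m e i Y) = affine m e i (g Y))}"

lemma centralizer_free:
  assumes g: "g \<in> centralizer" and h: "h \<in> centralizer" and Y: "Y \<in> S" and "g Y = h Y"
  shows "g = h"
proof (rule extensionalityI[of _ S])
  fix Z assume "Z \<in> S"
  then obtain e i where "e \<in> {1, -1}" "Z = affine m e i Y" using S_transitive Y by blast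
  then show "g Z = h Z" using assms unfolding centralizer_def by auto
qed (use g h in \<open>auto simp: centralizer_def\<close>)

text \<open>The image of an equivariant map is invariant under a transitive group, hence everything;
  finiteness of the orbit then gives injectivity.\<close>

lemma centralizer_Bij:
  assumes g: "g \<in> centralizer" shows "g \<in> Bij S"
proof -
  have "S \<subseteq> g ` S"
  proof
    fix Z assume "Z \<in> S"
    moreover have "g X \<in> S" using g X_in_S by (auto simp: centralizer_def)
    ultimately obtain e i where "e \<in> {1, -1}" "Z = affine m e i (g X)" using S_transitive by blast
    then have "Z = g (affine m e i X)" "affine m e i X \<in> S"
      using g X_in_S affine_in_S unfolding centralizer_def by auto
    then show "Z \<in> g ` S" by blast
  qed
  then have "g ` S = S" using g by (auto simp: centralizer_def)
  then show ?thesis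
    using g finite_S finite_surj_inj[of S g] by (auto simp: Bij_def bij_betw_def centralizer_def)
qed

lemma subgroup_centralizer: "subgroup centralizer (BijGroup S)"
proof (rule subgroup.intro)
  show "centralizer \<subseteq> carrier (BijGroup S)"
    using centralizer_Bij by (auto simp: BijGroup_def)
next
  fix g h assume "g \<in> centralizer" "h \<in> centralizer"
  then show "g \<otimes>\<^bsub>BijGroup S\<^esub> h \<in> centralizer"
    using affine_in_S by (auto simp: BijGroup_mult centralizer_Bij compose_def centralizer_def Pi_iff)
next
  show "\<one>\<^bsub>BijGroup S\<^esub> \<in> centralizer"
    using affine_in_S by (auto simp: BijGroup_one centralizer_def)
next
  fix g assume g: "g \<in> centralizer"
  let ?h = "inv\<^bsub>BijGroup S\<^esub> g"
  note inv = BijGroup_inv_apply[OF centralizer_Bij[OF g]]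
  have "?h (affine m e i Y) = affine m e i (?h Y)" if e: "e \<in> {1, -1}" and Y: "Y \<in> S" for e i Y
  proof -
    have "affine m e i Y = g (affine m e i (?h Y))"
      using g e inv(1,3)[OF Y] by (auto simp: centralizer_def)
    then show ?thesis using inv(2) affine_in_S[OF inv(3)[OF Y] e] by simp
  qed
  moreover have "?h \<in> extensional S"
    by (simp add: inv_BijGroup[OF centralizer_Bij[OF g]])
  ultimately show "?h \<in> centralizer" using inv(3) by (auto simp: centralizer_def)
qed

section \<open>Equivariance of contextual inversions, K and Q, and the group generated by K and
  Q_1\<close>

lemma contextual_inversion_apply:
  "Y \<in> S \<Longrightarrow> contextual_inversion m X q r Y = affine m (-1) (Y ! q + Y ! r) Y"
  by (simp add: contextual_inversion_def map_inversion add_Zmod affine_mod)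

lemma contextual_inversion_centralizer:
  assumes "q < length X" "r < length X"
  shows "contextual_inversion m X q r \<in> centralizer"
proof -
  have "contextual_inversion m X q r (affine m e i Y) = affine m e i (contextual_inversion m X q r Y)"
    if e: "e \<in> {1, -1}" and Y: "Y \<in> S" for e i Y
  proof -
    \<comment> \<open>With s = y_q + y_r, the tuple e Y + i has sum e s + 2i at q and r. Inverting
      it costs one i, leaving -e Y + e s + i, which is also e (-Y + s) + i.\<close>
    have "[affine m e i Y ! q + affine m e i Y ! r - i = e * (Y ! q + Y ! r) + i] (mod int m)"
      using assms length_S[OF Y] cong_mod_add_mod_diff[of "e * Y ! q + i" "int m" "e * Y ! r + i" i]
      by (simp add: algebra_simps)
    then have "affine m (- e) (affine m e i Y ! q + affine m e i Y ! r - i) Y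
      = affine m (- e) (e * (Y ! q + Y ! r) + i) Y"
      by (metis affine_cong)
    then show ?thesis
      using e Y affine_in_S[OF Y e] by (simp add: contextual_inversion_apply affine_affine)
  qed
  moreover have "contextual_inversion m X q r \<in> S \<rightarrow> S"
    using affine_in_S by (auto simp: contextual_inversion_apply)
  ultimately show ?thesis by (auto simp: centralizer_def contextual_inversion_def)
qed

lemma K_perm_eq: "K_perm m X = contextual_inversion m X 0 1"
  by (simp add: K_perm_def contextual_inversion_def)

lemma K_perm_centralizer: "K_perm m X \<in> centralizer"
  unfolding K_perm_eq using length_X by (intro contextual_inversion_centralizer) linarith+

lemma Q_perm_apply:
  "Y \<in> S \<Longrightarrow> Q_perm m X i Y = affine m 1 (if Y \<in> T_forms m X then i else - i) Y"
  by (simp add: Q_perm_def map_transp res_neg_eq affine_mod)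

text \<open>Signs multiply under composition, and \<open>T_neq_I\<close> makes the sign of a form
  well defined.\<close>

lemma affine_T_forms_iff:
  assumes "Y \<in> S" "e \<in> {1, -1}"
  shows "affine m e i Y \<in> T_forms m X \<longleftrightarrow> (Y \<in> T_forms m X \<longleftrightarrow> e = 1)"
  using assms T_neq_I T_neq_I[symmetric] by (auto simp: S_iff T_forms_iff affine_affine)

text \<open>An inversion reverses the direction of a transposition moved past it, and it also swaps
  T-forms with I-forms; the sign change built into Q compensates.\<close>

lemma Q_perm_centralizer: "Q_perm m X i \<in> centralizer"
proof -
  have "Q_perm m X i (affine m e j Y) = affine m e j (Q_perm m X i Y)"
    if e: "e \<in> {1, -1}" and Y: "Y \<in> S" for e j Y
    using e Y affine_in_S[OF Y e] affine_T_forms_iff[OF Y e]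
    by (auto simp: Q_perm_apply affine_affine algebra_simps)
  moreover have "Q_perm m X i \<in> S \<rightarrow> S"
    using affine_in_S by (auto simp: Q_perm_apply)
  ultimately show ?thesis by (auto simp: centralizer_def Q_perm_def)
qed

text \<open>The generated group already carries X to every point of \<open>S\<close>. An equivariant
  map thus agrees at X with a generated one, and \<open>centralizer_free\<close> makes them
  equal.\<close>

lemma carrier_contextual_group: "carrier (contextual_group m X) = centralizer"
proof -
  let ?K = "K_perm m X" and ?Q = "Q_perm m X \<one>\<^bsub>Zmod m\<^esub>"
  let ?C = "generate (BijGroup S) {?K, ?Q}"
  have JQ: "?K \<in> centralizer" "?Q \<in> centralizer"
    using K_perm_centralizer Q_perm_centralizer by auto
  then have sub: "?C \<subseteq> centralizer"
    using group.generate_subgroup_incl[OF group_BijGroup _ subgroup_centralizer] by simp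
  have mult: "(g \<otimes>\<^bsub>BijGroup S\<^esub> h) X = g (h X)" if "g \<in> ?C" "h \<in> ?C" for g h
    using BijGroup_mult[of g S h] centralizer_Bij sub that X_in_S
    by (simp add: subset_iff compose_def)
  have T: "\<exists>g\<in>?C. g X = affine m 1 (int k) X" for k
  proof (induction k)
    case 0
    then show ?case
      using generate.one[of "BijGroup S" "{?K, ?Q}"] X_in_S affine_one_zero[OF X_range]
      by (auto simp: BijGroup_one intro!: bexI[of _ "\<lambda>x\<in>S. x"])
  next
    case (Suc k)
    then obtain g where g: "g \<in> ?C" "g X = affine m 1 (int k) X" by blast
    have Q: "?Q \<in> ?C" by (simp add: generate.incl)
    have "\<one>\<^bsub>Zmod m\<^esub> = 1" by (simp add: residue_ring_def)
    then have "?Q (g X) = affine m 1 (int (Suc k)) X"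
      using affine_in_S[OF X_in_S, of 1 "int k"] T_forms_iff[of "g X"] g(2)
      by (auto simp: Q_perm_apply affine_affine algebra_simps)
    then show ?case using mult[OF Q g(1)] generate.eng[OF Q g(1)] by metis
  qed
  have T': "\<exists>g\<in>?C. g X = affine m 1 i X" for i
    using T[of "nat (i mod int m)"] m_gt_1 by (simp add: affine_mod)
  have I: "\<exists>g\<in>?C. g X = affine m (-1) i X" for i
  proof -
    let ?c = "X ! 0 + X ! 1"
    \<comment> \<open>By equivariance g (K X) is I_c applied to g X, that is -(X + c - i) + c = -X +
      i; this fixes the shift c - i.\<close>
    obtain g where g: "g \<in> ?C" "g X = affine m 1 (?c - i) X" using T' by blast
    have K: "?K \<in> ?C" by (simp add: generate.incl)
    have "g (?K X) = affine m (-1) ?c (g X)"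
      using sub g(1) X_in_S by (auto simp: K_perm_eq contextual_inversion_apply centralizer_def)
    also have "\<dots> = affine m (-1) i X" using g(2) by (simp add: affine_affine)
    finally show ?thesis using mult[OF g(1) K] generate.eng[OF g(1) K] by metis
  qed
  have "centralizer \<subseteq> ?C"
  proof
    fix h assume h: "h \<in> centralizer"
    then have "h X \<in> S" using X_in_S by (auto simp: centralizer_def)
    then obtain g where "g \<in> ?C" "g X = h X" using T' I unfolding S_iff by auto metis+
    then show "h \<in> ?C" using centralizer_free[of g h X] sub h X_in_S by auto
  qed
  with sub show ?thesis by (auto simp: contextual_group_def)
qed

lemma contextual_group_eq: "contextual_group m X = (BijGroup S)\<lparr>carrier := centralizer\<rparr>"
  using carrier_contextual_group by (simp add: contextual_group_def)

lemma orbit_centralizer: "(\<lambda>g. g X) ` centralizer = S"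
proof
  show "(\<lambda>g. g X) ` centralizer \<subseteq> S" using X_in_S by (auto simp: centralizer_def)
next
  show "S \<subseteq> (\<lambda>g. g X) ` centralizer"
  proof
    fix Y assume "Y \<in> S"
    then obtain e i where e: "e \<in> {1, -1}" and Y: "Y = affine m e i X" unfolding S_iff by blast
    show "Y \<in> (\<lambda>g. g X) ` centralizer"
    proof (cases "e = 1")
      case True
      have "X \<in> T_forms m X" using T_forms_iff affine_one_zero[OF X_range] by metis
      then have "Y = Q_perm m X i X" using True Y X_in_S by (simp add: Q_perm_apply)
      then show ?thesis using Q_perm_centralizer by blast
    next
      case False
      \<comment> \<open>K X = -X + c with c = x_1 + x_2 is an I-form, so Q_{c-i} shifts it by -(c -
        i) and produces -X + i.\<close>
      let ?K = "K_perm m X" and ?Q = "Q_perm m X (X ! 0 + X ! 1 - i)"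
      have JX: "?K X \<in> S" using K_perm_centralizer X_in_S by (auto simp: centralizer_def)
      have "?K X \<notin> T_forms m X"
        using T_neq_I[symmetric] X_in_S by (simp add: K_perm_eq contextual_inversion_apply T_forms_iff)
      then have "Y = (?Q \<otimes>\<^bsub>BijGroup S\<^esub> ?K) X"
        using False e Y X_in_S JX
        by (simp add: BijGroup_mult centralizer_Bij K_perm_centralizer Q_perm_centralizer compose_def Q_perm_apply)
          (simp add: K_perm_eq contextual_inversion_apply affine_affine)
      then show ?thesis
        using subgroup.m_closed[OF subgroup_centralizer Q_perm_centralizer K_perm_centralizer] by blast
    qed
  qed
qed

end

section \<open>The morphism of actions induced by an affine map\<close>

theorem corollary3p3:
  fixes m n :: nat and X :: "int list" and f :: "int \<Rightarrow> int" and a b :: int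
    and P :: "(nat \<times> nat) set" and G\<^sub>0 :: "(int list \<Rightarrow> int list) monoid"
  assumes "m \<ge> 1"
    and "length X = n" and "set X \<subseteq> carrier (Zmod m)"
    and "a \<in> carrier (Zmod m)" and "b \<in> carrier (Zmod m)"
    and "\<And>z. z \<in> carrier (Zmod m) \<Longrightarrow> f z = a \<otimes>\<^bsub>Zmod m\<^esub> z \<oplus>\<^bsub>Zmod m\<^esub> b"
    and "tritone_condition m X" and "tritone_condition m (map f X)"
    and "P \<subseteq> {..<n} \<times> {..<n}"
    and "subgroup (carrier G\<^sub>0) (contextual_group m X)"
    and "G\<^sub>0 = (contextual_group m X)
           \<lparr>carrier := generate (contextual_group m X)
                         {contextual_inversion m X q r | q r. (q, r) \<in> P}\<rparr>"
  shows "(\<exists>!\<phi>. \<phi> \<in> extensional (carrier G\<^sub>0) \<and> \<phi> \<in> hom G\<^sub>0 (contextual_group m (map f X)) \<and>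
            (\<forall>(q, r) \<in> P. \<phi> (contextual_inversion m X q r) = contextual_inversion m (map f X) q r))
       \<and> (\<forall>\<phi>. \<phi> \<in> hom G\<^sub>0 (contextual_group m (map f X)) \<and>
            (\<forall>(q, r) \<in> P. \<phi> (contextual_inversion m X q r) = contextual_inversion m (map f X) q r)
          \<longrightarrow>
            action_morphism (map f) \<phi>
              G\<^sub>0 (TI_orbit m X) (eval_action (TI_orbit m X))
              (contextual_group m (map f X)) (TI_orbit m (map f X))
              (eval_action (TI_orbit m (map f X)))
          \<and> orbit G\<^sub>0 (eval_action (TI_orbit m X)) X \<subseteq> TI_orbit m X
          \<and> simply_transitive_morphism (map f) \<phi>
              G\<^sub>0 (orbit G\<^sub>0 (eval_action (TI_orbit m X)) X)
              (eval_action (orbit G\<^sub>0 (eval_action (TI_orbit m X)) X))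
              (contextual_group m (map f X)) (TI_orbit m (map f X))
              (eval_action (TI_orbit m (map f X))))"
proof -
  let ?X' = "map f X"
  let ?J = "\<lambda>(q, r). contextual_inversion m X q r"
  let ?J' = "\<lambda>(q, r). contextual_inversion m ?X' q r"
  interpret X: tritone_segment m X
    using assms by unfold_locales auto
  have f: "f z = (a * z + b) mod int m" if "z \<in> {0..<int m}" for z
    using assms(6) that by (auto simp: residue_ring_def mod_simps)
  then have map_f: "map f Y = affine m a b Y" if "Y \<in> X.S" for Y
    using X.S_range[OF that] by (auto simp: affine_def)
  have "set ?X' \<subseteq> carrier (Zmod m)"
    using f X.X_range X.m_gt_1 by (auto simp: X.carrier_Zmod)
  then interpret X': tritone_segment m ?X'
    using assms by unfold_locales auto
  have f_S: "map f \<in> X.S \<rightarrow> X'.S"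
  proof
    fix Y assume Y: "Y \<in> X.S"
    then obtain e i where e: "e \<in> {1, -1}" "Y = affine m e i X" unfolding X.S_iff by blast
    \<comment> \<open>The constant solves a (e X + i) + b = e (a X + b) + c: f carries T_i to T_{ai}
      and I_i to I_{ai+2b}.\<close>
    then have "map f Y = affine m e (a * i + b - e * b) ?X'"
      using map_f[OF Y] map_f[OF X.X_in_S] by (simp add: affine_affine algebra_simps)
    then show "map f Y \<in> X'.S" using e X'.S_iff by blast
  qed
  have fJ: "intertwines X.S (map f) (?J p) (?J' p)" if pP: "p \<in> P" for p
  proof -
    obtain q r where p: "p = (q, r)" "q < n" "r < n" using pP assms(9) by (cases p) blast
    have "map f (?J p Y) = ?J' p (map f Y)" if Y: "Y \<in> X.S" for Y
    proof -
      have JY: "?J p Y = affine m (-1) (Y ! q + Y ! r) Y"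
        using p Y by (simp add: X.contextual_inversion_apply)
      \<comment> \<open>Entries q and r of f(Y) contribute 2b to the inversion index, and inverting
        f(Y) takes one b away; the remaining b is the one f adds to J(Y).\<close>
      have "[a * (Y ! q + Y ! r) + b = affine m a b Y ! q + affine m a b Y ! r - b] (mod int m)"
        using p X.length_S[OF Y] assms(2)
          cong_mod_add_mod_diff[of "a * Y ! q + b" "int m" "a * Y ! r + b" b]
        by (simp add: algebra_simps cong_sym_eq)
      then have "affine m (- a) (a * (Y ! q + Y ! r) + b) Y
          = affine m (- a) (affine m a b Y ! q + affine m a b Y ! r - b) Y"
        by (metis affine_cong)
      moreover have "?J p Y \<in> X.S" using JY X.affine_in_S[OF Y] by simp
      moreover have "map f Y \<in> X'.S" using f_S Y by blast
      ultimately show ?thesis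
        using p Y JY by (simp add: map_f X'.contextual_inversion_apply affine_affine)
    qed
    then show ?thesis by (simp add: intertwines_def)
  qed
  have J: "?J ` P \<subseteq> X.centralizer" and J': "?J' ` P \<subseteq> X'.centralizer"
    using assms(2,9)
    by (auto intro!: X.contextual_inversion_centralizer X'.contextual_inversion_centralizer)
  then have J_Bij: "?J ` P \<subseteq> Bij X.S" using X.centralizer_Bij by blast
  define H where "H = generate (BijGroup X.S) (?J ` P)"
  \<comment> \<open>Generating inside the contextual group or inside the full symmetric group of
    \<open>S\<close> gives the same subgroup, so the general results on \<open>BijGroup\<close>
    apply.\<close>
  have "{contextual_inversion m X q r | q r. (q, r) \<in> P} = ?J ` P" by auto
  then have G\<^sub>0: "G\<^sub>0 = (BijGroup X.S)\<lparr>carrier := H\<rparr>"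
    unfolding assms(11) X.contextual_group_eq H_def
    using group.generate_consistent[OF group_BijGroup J X.subgroup_centralizer] by simp
  have H_centralizer: "H \<subseteq> X.centralizer"
    unfolding H_def using group.generate_subgroup_incl[OF group_BijGroup J X.subgroup_centralizer] .
  note hyps = X'.subgroup_centralizer f_S J_Bij J' fJ H_def
  note H = subgroup_H[OF hyps]
  let ?A = "(\<lambda>g. g X) ` H"
  have A: "orbit G\<^sub>0 (eval_action X.S) X = ?A"
    unfolding G\<^sub>0 by (rule orbit_eval_action[OF X.X_in_S])
  have HS: "g \<in> X.S \<rightarrow> X.S" if "g \<in> H" for g
    using that H_centralizer by (auto simp: X.centralizer_def)
  then have AS: "?A \<subseteq> X.S" using X.X_in_S by blast
  \<comment> \<open>The orbit of f(X) under its contextual group is all of S', so the orbit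
    statement covers the whole action.\<close>
  have G': "simply_transitive (contextual_group m ?X') X'.S (eval_action X'.S)"
    using simply_transitive_orbit[OF X'.subgroup_centralizer X'.X_in_S X'.centralizer_free]
    by (simp add: X'.orbit_centralizer X'.contextual_group_eq)
  have stA: "simply_transitive G\<^sub>0 ?A (eval_action ?A)"
    unfolding G\<^sub>0 using simply_transitive_orbit[OF H X.X_in_S] X.centralizer_free H_centralizer by blast
  have ex1: "\<exists>!\<phi>. \<phi> \<in> extensional (carrier G\<^sub>0) \<and> \<phi> \<in> hom G\<^sub>0 (contextual_group m ?X') \<and>
      (\<forall>(q, r)\<in>P. \<phi> (contextual_inversion m X q r) = contextual_inversion m ?X' q r)"
    using ex1_hom[OF hyps X.X_in_S X'.centralizer_free]
    by (simp add: G\<^sub>0 X'.contextual_group_eq case_prod_unfold)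
  \<comment> \<open>Stated for a variable invariant subset so that it serves both S and the orbit of
    X under \<open>G\<^sub>0\<close>.\<close>
  have morphism: "action_morphism (map f) \<phi> G\<^sub>0 A (eval_action A)
      (contextual_group m ?X') X'.S (eval_action X'.S)"
    if \<phi>: "\<phi> \<in> hom G\<^sub>0 (contextual_group m ?X')"
      and \<phi>J: "\<forall>(q, r)\<in>P. \<phi> (contextual_inversion m X q r) = contextual_inversion m ?X' q r"
      and A: "group_action G\<^sub>0 A (eval_action A)" "A \<subseteq> X.S" for \<phi> A
  proof -
    have "intertwines X.S (map f) g (\<phi> g)" if "g \<in> H" for g
      using hom_intertwines[OF hyps _ _ that, of \<phi>] \<phi> \<phi>J
      by (auto simp: G\<^sub>0 X'.contextual_group_eq)
    then show ?thesis
      unfolding action_morphism_def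
      using \<phi> A G' f_S by (auto simp: simply_transitive_def G\<^sub>0 eval_action_def intertwines_def)
  qed
  have "group_action G\<^sub>0 X.S (eval_action X.S)"
    unfolding G\<^sub>0 by (rule group_action_eval_action[OF H]) (use HS in auto)
  then show ?thesis
    using ex1 morphism AS stA G'
    unfolding A simply_transitive_morphism_def by (auto simp: simply_transitive_def)
qed

end
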